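(* For every integer $k\ge 1$, the Boolean graph query $(k+2)$-Clique cannot be maintained under insertions by a $k$-ary $\mathrm{DynProp}$-program with unary auxiliary functions.
   Context: Graphs are directed graphs given as structures over the input schema $\{E\}$, $E$ binary. A graph is in $m$-Clique if it has $m$ distinct nodes $v_1,\dots,v_m$ such that $(v_i,v_j)\in E$ or $(v_j,v_i)\in E$ for all $i\ne j$. Dynamic complexity framework with auxiliary functions. A dynamic schema is a pair $(\tau_{\mathrm{in}},\tau_{\mathrm{aux}})$; here $\tau_{\mathrm{aux}}$ consists of relation symbols and function symbols, the latter of arity at most $1$ (constants being $0$-ary functions); $\tau=\tau_{\mathrm{in}}\cup\tau_{\mathrm{aux}}$. A modification is an insertion $\mathrm{ins}_S(\vec a)$ or deletion $\mathrm{del}_S(\vec a)$ of a tuple $\vec a$ into/from $S\in\tau_{\mathrm{in}}$. The update program contains, for each auxiliary relation symbol $R$ and each $\delta\in\{\mathrm{ins}_S,\mathrm{del}_S\}$, a quantifier-free formula $\varphi^R_\delta(\vec x;\vec y)$ over $\tau$ (terms may use the function symbols), and for each auxiliary function symbol $f$ an update term $t^f_\delta(\vec x;\vec y)$ built from variables, function symbols of $\tau$ and the if-then-else construct $\mathrm{ITE}(\varphi,t_1,t_2)$ with $\varphi$ quantifier-free (it evaluates to $t_1$ if $\varphi$ holds and to $t_2$ otherwise). Program states are $(D,\mathcal I,\mathcal A)$ over a finite domain $D$. Applying $\delta(\vec a)$ to a state $\mathcal S$ modifies the input by $\delta(\vec a)$, reinterprets each $R$ as $\{\vec b:\mathcal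 S\models\varphi^R_\delta(\vec a;\vec b)\}$ and each $f$ by $\vec b\mapsto t^f_\delta(\vec a;\vec b)$ evaluated in $\mathcal S$; sequences are applied one after another. A dynamic program $(P,\mathrm{Init},Q)$ has an arbitrary initialization mapping $\mathrm{Init}$ and a designated $0$-ary query symbol $Q$; it maintains a Boolean query $\mathcal Q$ under insertions if for every input database $\mathcal D$ over any finite domain and every sequence $\alpha$ of insertions, the value of $Q$ in the state reached from $(D,\mathcal D,\mathrm{Init}(\mathcal D))$ by $\alpha$ equals $\mathcal Q(\alpha(\mathcal D))$. The program is $k$-ary if all auxiliary relation symbols have arity at most $k$. *)

theory Defs
  imports Main
begin

section \<open>Dynamic schemas and input databases\<close>

record ('i, 'r, 'f) dyn_schema =
  in_rels :: "'i set"
  in_arity :: "'i \<Rightarrow> nat"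
  aux_rels :: "'r set"
  aux_arity :: "'r \<Rightarrow> nat"
  aux_funs :: "'f set"
  fun_arity :: "'f \<Rightarrow> nat"

definition finite_schema :: "('i, 'r, 'f, 'z) dyn_schema_scheme \<Rightarrow> bool" where
  "finite_schema \<sigma> \<longleftrightarrow> finite (in_rels \<sigma>) \<and> finite (aux_rels \<sigma>) \<and> finite (aux_funs \<sigma>)"

definition tuples :: "'d set \<Rightarrow> nat \<Rightarrow> 'd list set" where
  "tuples D n = {as. set as \<subseteq> D \<and> length as = n}"

type_synonym ('i, 'd) database = "'i \<Rightarrow> 'd list set"

definition input_database ::
    "('i, 'r, 'f, 'z) dyn_schema_scheme \<Rightarrow> 'd set \<Rightarrow> ('i, 'd) database \<Rightarrow> bool" where
  "input_database \<sigma> D I \<longleftrightarrow> (\<forall>S\<in>in_rels \<sigma>. I S \<subseteq> tuples D (in_arity \<sigma> S))"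

text \<open>An abstract modification \<open>Ins S\<close> or \<open>Del S\<close> becomes a concrete one when paired with a tuple.\<close>

datatype 'i modification = Ins (mod_rel: 'i) | Del (mod_rel: 'i)

fun modify :: "'i modification \<times> 'd list \<Rightarrow> ('i, 'd) database \<Rightarrow> ('i, 'd) database" where
  "modify (Ins S, as) I = I(S := insert as (I S))"
| "modify (Del S, as) I = I(S := I S - {as})"

definition insertions ::
    "('i, 'r, 'f, 'z) dyn_schema_scheme \<Rightarrow> 'd set \<Rightarrow> ('i modification \<times> 'd list) set" where
  "insertions \<sigma> D = {(Ins S, as) |S as. S \<in> in_rels \<sigma> \<and> as \<in> tuples D (in_arity \<sigma> S)}"


section \<open>Quantifier-free update formulas and update terms\<close>

text \<open>In an update formula or update term with variables \<open>(x; y)\<close>, \<open>ModVar i\<close> is the variable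
  \<open>x\<^sub>i\<close>, standing for a component of the modified tuple, and \<open>ArgVar j\<close> is \<open>y\<^sub>j\<close>, standing for
  an argument of the updated relation or function. Indices start at 0. Constants are
  \<open>0\<close>-ary function symbols.\<close>

datatype var = ModVar nat | ArgVar nat

datatype 'f trm = Var var | App 'f "'f trm list"

datatype ('i, 'r, 'f) qf_formula =
    Top
  | Eq "'f trm" "'f trm"
  | InAtom 'i "'f trm list"
  | AuxAtom 'r "'f trm list"
  | Neg "('i, 'r, 'f) qf_formula"
  | And "('i, 'r, 'f) qf_formula" "('i, 'r, 'f) qf_formula"
  | Or "('i, 'r, 'f) qf_formula" "('i, 'r, 'f) qf_formula"

datatype ('i, 'r, 'f) update_term =
    UVar var
  | UApp 'f "('i, 'r, 'f) update_term list"
  | ITE "('i, 'r, 'f) qf_formula" "('i, 'r, 'f) update_term" "('i, 'r, 'f) update_term"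

text \<open>Well-formedness over a schema, for \<open>n\<close> variables \<open>x\<close> and \<open>m\<close> variables \<open>y\<close>.\<close>

fun wf_var :: "nat \<Rightarrow> nat \<Rightarrow> var \<Rightarrow> bool" where
  "wf_var n m (ModVar i) \<longleftrightarrow> i < n"
| "wf_var n m (ArgVar j) \<longleftrightarrow> j < m"

fun wf_trm :: "('i, 'r, 'f, 'z) dyn_schema_scheme \<Rightarrow> nat \<Rightarrow> nat \<Rightarrow> 'f trm \<Rightarrow> bool" where
  "wf_trm \<sigma> n m (Var v) \<longleftrightarrow> wf_var n m v"
| "wf_trm \<sigma> n m (App f ts) \<longleftrightarrow>
     f \<in> aux_funs \<sigma> \<and> length ts = fun_arity \<sigma> f \<and> (\<forall>t\<in>set ts. wf_trm \<sigma> n m t)"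

fun wf_formula ::
    "('i, 'r, 'f, 'z) dyn_schema_scheme \<Rightarrow> nat \<Rightarrow> nat \<Rightarrow> ('i, 'r, 'f) qf_formula \<Rightarrow> bool" where
  "wf_formula \<sigma> n m Top \<longleftrightarrow> True"
| "wf_formula \<sigma> n m (Eq s t) \<longleftrightarrow> wf_trm \<sigma> n m s \<and> wf_trm \<sigma> n m t"
| "wf_formula \<sigma> n m (InAtom S ts) \<longleftrightarrow>
     S \<in> in_rels \<sigma> \<and> length ts = in_arity \<sigma> S \<and> (\<forall>t\<in>set ts. wf_trm \<sigma> n m t)"
| "wf_formula \<sigma> n m (AuxAtom R ts) \<longleftrightarrow>
     R \<in> aux_rels \<sigma> \<and> length ts = aux_arity \<sigma> R \<and> (\<forall>t\<in>set ts. wf_trm \<sigma> n m t)"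
| "wf_formula \<sigma> n m (Neg \<phi>) \<longleftrightarrow> wf_formula \<sigma> n m \<phi>"
| "wf_formula \<sigma> n m (And \<phi> \<psi>) \<longleftrightarrow> wf_formula \<sigma> n m \<phi> \<and> wf_formula \<sigma> n m \<psi>"
| "wf_formula \<sigma> n m (Or \<phi> \<psi>) \<longleftrightarrow> wf_formula \<sigma> n m \<phi> \<and> wf_formula \<sigma> n m \<psi>"

fun wf_update_term ::
    "('i, 'r, 'f, 'z) dyn_schema_scheme \<Rightarrow> nat \<Rightarrow> nat \<Rightarrow> ('i, 'r, 'f) update_term \<Rightarrow> bool" where
  "wf_update_term \<sigma> n m (UVar v) \<longleftrightarrow> wf_var n m v"
| "wf_update_term \<sigma> n m (UApp f ts) \<longleftrightarrow>
     f \<in> aux_funs \<sigma> \<and> length ts = fun_arity \<sigma> f \<and> (\<forall>t\<in>set ts. wf_update_term \<sigma> n m t)"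
| "wf_update_term \<sigma> n m (ITE \<phi> s t) \<longleftrightarrow>
     wf_formula \<sigma> n m \<phi> \<and> wf_update_term \<sigma> n m s \<and> wf_update_term \<sigma> n m t"


section \<open>Program states and evaluation\<close>

record ('r, 'f, 'd) aux_data =
  rel_of :: "'r \<Rightarrow> 'd list set"
  fun_of :: "'f \<Rightarrow> 'd list \<Rightarrow> 'd"

text \<open>Auxiliary functions are total HOL functions, of which only the restriction to tuples over
  the domain matters; on those they must take values in the domain.\<close>

definition auxiliary_data ::
    "('i, 'r, 'f, 'z) dyn_schema_scheme \<Rightarrow> 'd set \<Rightarrow> ('r, 'f, 'd) aux_data \<Rightarrow> bool" where
  "auxiliary_data \<sigma> D A \<longleftrightarrow>
     (\<forall>R\<in>aux_rels \<sigma>. rel_of A R \<subseteq> tuples D (aux_arity \<sigma> R)) \<and>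
     (\<forall>f\<in>aux_funs \<sigma>. \<forall>bs\<in>tuples D (fun_arity \<sigma> f). fun_of A f bs \<in> D)"

record ('i, 'r, 'f, 'd) state =
  state_dom :: "'d set"
  state_in :: "('i, 'd) database"
  state_aux :: "('r, 'f, 'd) aux_data"

fun eval_var :: "'d list \<Rightarrow> 'd list \<Rightarrow> var \<Rightarrow> 'd" where
  "eval_var as bs (ModVar i) = as ! i"
| "eval_var as bs (ArgVar j) = bs ! j"

fun eval_trm :: "('i, 'r, 'f, 'd) state \<Rightarrow> 'd list \<Rightarrow> 'd list \<Rightarrow> 'f trm \<Rightarrow> 'd" where
  "eval_trm \<S> as bs (Var v) = eval_var as bs v"
| "eval_trm \<S> as bs (App f ts) = fun_of (state_aux \<S>) f (map (eval_trm \<S> as bs) ts)"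

fun sat :: "('i, 'r, 'f, 'd) state \<Rightarrow> 'd list \<Rightarrow> 'd list \<Rightarrow> ('i, 'r, 'f) qf_formula \<Rightarrow> bool" where
  "sat \<S> as bs Top \<longleftrightarrow> True"
| "sat \<S> as bs (Eq s t) \<longleftrightarrow> eval_trm \<S> as bs s = eval_trm \<S> as bs t"
| "sat \<S> as bs (InAtom S ts) \<longleftrightarrow> map (eval_trm \<S> as bs) ts \<in> state_in \<S> S"
| "sat \<S> as bs (AuxAtom R ts) \<longleftrightarrow> map (eval_trm \<S> as bs) ts \<in> rel_of (state_aux \<S>) R"
| "sat \<S> as bs (Neg \<phi>) \<longleftrightarrow> \<not> sat \<S> as bs \<phi>"
| "sat \<S> as bs (And \<phi> \<psi>) \<longleftrightarrow> sat \<S> as bs \<phi> \<and> sat \<S> as bs \<psi>"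
| "sat \<S> as bs (Or \<phi> \<psi>) \<longleftrightarrow> sat \<S> as bs \<phi> \<or> sat \<S> as bs \<psi>"

fun eval_update_term ::
    "('i, 'r, 'f, 'd) state \<Rightarrow> 'd list \<Rightarrow> 'd list \<Rightarrow> ('i, 'r, 'f) update_term \<Rightarrow> 'd" where
  "eval_update_term \<S> as bs (UVar v) = eval_var as bs v"
| "eval_update_term \<S> as bs (UApp f ts) =
     fun_of (state_aux \<S>) f (map (eval_update_term \<S> as bs) ts)"
| "eval_update_term \<S> as bs (ITE \<phi> s t) =
     (if sat \<S> as bs \<phi> then eval_update_term \<S> as bs s else eval_update_term \<S> as bs t)"


section \<open>Dynamic programs\<close>

record ('i, 'r, 'f, 'd) dyn_program = "('i, 'r, 'f) dyn_schema" +
  rel_update :: "'r \<Rightarrow> 'i modification \<Rightarrow> ('i, 'r, 'f) qf_formula"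
  fun_update :: "'f \<Rightarrow> 'i modification \<Rightarrow> ('i, 'r, 'f) update_term"
  Init :: "'d set \<Rightarrow> ('i, 'd) database \<Rightarrow> ('r, 'f, 'd) aux_data"
  query_sym :: "'r"

text \<open>Structures have nonempty domains, so that constants can be interpreted.\<close>

definition DynProp_program :: "('i, 'r, 'f, 'd) dyn_program \<Rightarrow> bool" where
  "DynProp_program P \<longleftrightarrow>
     finite_schema P \<and>
     (\<forall>R\<in>aux_rels P. \<forall>\<delta>. mod_rel \<delta> \<in> in_rels P \<longrightarrow>
        wf_formula P (in_arity P (mod_rel \<delta>)) (aux_arity P R) (rel_update P R \<delta>)) \<and>
     (\<forall>f\<in>aux_funs P. \<forall>\<delta>. mod_rel \<delta> \<in> in_rels P \<longrightarrow>
        wf_update_term P (in_arity P (mod_rel \<delta>)) (fun_arity P f) (fun_update P f \<delta>)) \<and>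
     (\<forall>D I. finite D \<and> D \<noteq> {} \<and> input_database P D I \<longrightarrow> auxiliary_data P D (Init P D I)) \<and>
     query_sym P \<in> aux_rels P \<and> aux_arity P (query_sym P) = 0"

definition unary_functions :: "('i, 'r, 'f, 'd) dyn_program \<Rightarrow> bool" where
  "unary_functions P \<longleftrightarrow> (\<forall>f\<in>aux_funs P. fun_arity P f \<le> 1)"

definition program_arity_le :: "nat \<Rightarrow> ('i, 'r, 'f, 'd) dyn_program \<Rightarrow> bool" where
  "program_arity_le k P \<longleftrightarrow> (\<forall>R\<in>aux_rels P. aux_arity P R \<le> k)"

text \<open>All update formulas and terms are evaluated in the state before the modification.\<close>

fun apply_mod :: "('i, 'r, 'f, 'd) dyn_program \<Rightarrow> 'i modification \<times> 'd list \<Rightarrow>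
    ('i, 'r, 'f, 'd) state \<Rightarrow> ('i, 'r, 'f, 'd) state" where
  "apply_mod P (\<delta>, as) \<S> =
     \<lparr>state_dom = state_dom \<S>,
      state_in = modify (\<delta>, as) (state_in \<S>),
      state_aux =
        \<lparr>rel_of = (\<lambda>R. {bs \<in> tuples (state_dom \<S>) (aux_arity P R). sat \<S> as bs (rel_update P R \<delta>)}),
         fun_of = (\<lambda>f bs. eval_update_term \<S> as bs (fun_update P f \<delta>))\<rparr>\<rparr>"

definition initial_state ::
    "('i, 'r, 'f, 'd) dyn_program \<Rightarrow> 'd set \<Rightarrow> ('i, 'd) database \<Rightarrow> ('i, 'r, 'f, 'd) state" where
  "initial_state P D I = \<lparr>state_dom = D, state_in = I, state_aux = Init P D I\<rparr>"

definition query_value :: "('i, 'r, 'f, 'd) dyn_program \<Rightarrow> ('i, 'r, 'f, 'd) state \<Rightarrow> bool" where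
  "query_value P \<S> \<longleftrightarrow> [] \<in> rel_of (state_aux \<S>) (query_sym P)"

definition maintains_under_insertions ::
    "('i, 'r, 'f, 'd) dyn_program \<Rightarrow> ('d set \<Rightarrow> ('i, 'd) database \<Rightarrow> bool) \<Rightarrow> bool" where
  "maintains_under_insertions P \<Q> \<longleftrightarrow>
     (\<forall>D I \<alpha>. finite D \<and> D \<noteq> {} \<and> input_database P D I \<and> set \<alpha> \<subseteq> insertions P D \<longrightarrow>
        query_value P (fold (apply_mod P) \<alpha> (initial_state P D I)) = \<Q> D (fold modify \<alpha> I))"


section \<open>The clique query\<close>

datatype graph_sym = E

definition graph_program :: "(graph_sym, 'r, 'f, 'd) dyn_program \<Rightarrow> bool" where
  "graph_program P \<longleftrightarrow> in_rels P = {E} \<and> in_arity P E = 2"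

definition Clique :: "nat \<Rightarrow> 'd set \<Rightarrow> (graph_sym, 'd) database \<Rightarrow> bool" where
  "Clique m D I \<longleftrightarrow>
     (\<exists>vs. length vs = m \<and> distinct vs \<and> set vs \<subseteq> D \<and>
        (\<forall>i<m. \<forall>j<m. i \<noteq> j \<longrightarrow> [vs ! i, vs ! j] \<in> I E \<or> [vs ! j, vs ! i] \<in> I E))"

end

theory Submission
  imports Defs "HOL-Library.FuncSet" "HOL-Library.Countable"
begin

text \<open>Take \<open>k + 1\<close> parts of \<open>n\<close> base vertices each, and for every set \<open>C\<close> of transversals the graph
  in which each \<open>c \<in> C\<close> is coned off by an apex. Joining all vertices of a transversal \<open>c\<close> creates a
  \<open>(k + 2)\<close>-clique iff \<open>c \<in> C\<close>. There are \<open>2 ^ n ^ (k + 1)\<close> choices of \<open>C\<close>. As the number of insertions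
  is constant and the updates are quantifier-free, the answer depends only on the part of the
  initial state reachable from the base vertices by terms of bounded depth. As the functions are
  at most unary, this part has \<open>O(n)\<close> elements, so it is described by \<open>O(n log n)\<close> bits for
  its elements and function values, \<open>O(n ^ k)\<close> bits for the auxiliary relations, and \<open>O(n)\<close> bits
  telling which reached apices belong to \<open>C\<close>. Hence for large \<open>n\<close> two different sets \<open>C\<close> are
  indistinguishable.\<close>

section \<open>Locality of quantifier-free updates\<close>

text \<open>\<open>X\<close> is a chain of levels: a function applied at a level
  \<open>i < n\<close> has the same value in both states and climbs at most one level. So
  \<open>n\<close> is the nesting depth of functions up to which the two states can be
  compared.\<close>

definition agree ::
    "('i, 'r, 'f, 'z) dyn_schema_scheme \<Rightarrow> nat \<Rightarrow> (nat \<Rightarrow> 'd set) \<Rightarrow>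
     ('i, 'r, 'f, 'd) state \<Rightarrow> ('i, 'r, 'f, 'd) state \<Rightarrow> bool" where
  "agree \<sigma> n X \<S> \<S>' \<longleftrightarrow>
     mono X \<and> state_dom \<S> = state_dom \<S>' \<and>
     (\<forall>i<n. \<forall>f\<in>aux_funs \<sigma>. \<forall>bs\<in>tuples (X i) (fun_arity \<sigma> f).
        fun_of (state_aux \<S>) f bs = fun_of (state_aux \<S>') f bs \<and>
        fun_of (state_aux \<S>) f bs \<in> X (Suc i)) \<and>
     (\<forall>R\<in>aux_rels \<sigma>. \<forall>bs\<in>tuples (X n) (aux_arity \<sigma> R).
        bs \<in> rel_of (state_aux \<S>) R \<longleftrightarrow> bs \<in> rel_of (state_aux \<S>') R) \<and>
     (\<forall>S\<in>in_rels \<sigma>. \<forall>bs\<in>tuples (X n) (in_arity \<sigma> S).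
        bs \<in> state_in \<S> S \<longleftrightarrow> bs \<in> state_in \<S>' S)"

lemma eval_var_in:
  assumes "wf_var (length as) (length bs) v" "set as \<subseteq> Z" "set bs \<subseteq> Z"
  shows "eval_var as bs v \<in> Z"
  using assms by (cases v) auto

text \<open>Each application climbs at most one level, and \<open>size t\<close> is an upper bound
  for the nesting depth of \<open>t\<close>.\<close>

lemma agree_eval_trm:
  assumes ag: "agree \<sigma> N X \<S> \<S>'"
    and sub: "set as \<subseteq> X i" "set bs \<subseteq> X i"
    and "wf_trm \<sigma> (length as) (length bs) t" "i + size t \<le> N"
  shows "eval_trm \<S> as bs t = eval_trm \<S>' as bs t \<and> eval_trm \<S> as bs t \<in> X (i + size t)"
  using assms(4,5)
proof (induction t)
  case (Var v)
  have "X i \<subseteq> X (i + size (Var v))" using ag by (simp add: agree_def monoD)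
  then show ?case using Var eval_var_in[OF _ sub] by auto
next
  case (App f ts)
  \<comment> \<open>Arguments of different sizes are lifted to the common level \<open>?j\<close>;
    applying \<open>f\<close> then accounts for the \<open>Suc\<close> in the size of
    \<open>App f ts\<close>.\<close>
  let ?j = "i + size_list size ts"
  have mono: "mono X" using ag by (simp add: agree_def)
  have IH: "eval_trm \<S> as bs t = eval_trm \<S>' as bs t \<and> eval_trm \<S> as bs t \<in> X ?j"
    if t: "t \<in> set ts" for t
  proof -
    have le: "size t \<le> size_list size ts" using t by (rule size_list_estimation') simp
    have "eval_trm \<S> as bs t = eval_trm \<S>' as bs t \<and> eval_trm \<S> as bs t \<in> X (i + size t)"
      using App.IH[OF t] App.prems t le by auto
    moreover have "X (i + size t) \<subseteq> X ?j" using mono le by (simp add: monoD)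
    ultimately show ?thesis by blast
  qed
  have eq: "map (eval_trm \<S> as bs) ts = map (eval_trm \<S>' as bs) ts" using IH by simp
  have "map (eval_trm \<S> as bs) ts \<in> tuples (X ?j) (fun_arity \<sigma> f)"
    using IH[THEN conjunct2] App.prems by (auto simp: tuples_def)
  moreover have "?j < N" "f \<in> aux_funs \<sigma>" using App.prems by auto
  ultimately have "fun_of (state_aux \<S>) f (map (eval_trm \<S> as bs) ts) =
      fun_of (state_aux \<S>') f (map (eval_trm \<S> as bs) ts)"
      "fun_of (state_aux \<S>) f (map (eval_trm \<S> as bs) ts) \<in> X (Suc ?j)"
    using ag unfolding agree_def by blast+
  then show ?case by (simp flip: eq del: map_eq_conv)
qed

lemma agree_eval_trms:
  assumes ag: "agree \<sigma> N X \<S> \<S>'"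
    and sub: "set as \<subseteq> X i" "set bs \<subseteq> X i"
    and wf: "\<forall>t\<in>set ts. wf_trm \<sigma> (length as) (length bs) t"
    and le: "i + size_list size ts \<le> N"
  shows "map (eval_trm \<S> as bs) ts = map (eval_trm \<S>' as bs) ts"
    and "map (eval_trm \<S> as bs) ts \<in> tuples (X N) (length ts)"
proof -
  have *: "eval_trm \<S> as bs t = eval_trm \<S>' as bs t \<and> eval_trm \<S> as bs t \<in> X N"
    if t: "t \<in> set ts" for t
  proof -
    have "size t \<le> size_list size ts" using t by (rule size_list_estimation') simp
    then have "i + size t \<le> N" using le by simp
    moreover have "X (i + size t) \<subseteq> X N"
      using ag \<open>i + size t \<le> N\<close> by (simp add: agree_def monoD)
    ultimately show ?thesis using agree_eval_trm[OF ag sub] wf t by blast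
  qed
  show "map (eval_trm \<S> as bs) ts = map (eval_trm \<S>' as bs) ts" using * by simp
  show "map (eval_trm \<S> as bs) ts \<in> tuples (X N) (length ts)"
    using *[THEN conjunct2] by (auto simp: tuples_def)
qed

lemma agree_sat:
  assumes ag: "agree \<sigma> N X \<S> \<S>'"
    and sub: "set as \<subseteq> X i" "set bs \<subseteq> X i"
    and "wf_formula \<sigma> (length as) (length bs) \<phi>" "i + size \<phi> \<le> N"
  shows "sat \<S> as bs \<phi> \<longleftrightarrow> sat \<S>' as bs \<phi>"
  using assms(4,5)
proof (induction \<phi>)
  case (Eq s t)
  then show ?case using agree_eval_trm[OF ag sub, of s] agree_eval_trm[OF ag sub, of t] by auto
next
  case (InAtom S ts)
  then have "map (eval_trm \<S> as bs) ts = map (eval_trm \<S>' as bs) ts"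
    "map (eval_trm \<S> as bs) ts \<in> tuples (X N) (in_arity \<sigma> S)" "S \<in> in_rels \<sigma>"
    using agree_eval_trms[OF ag sub, of ts] by auto
  then show ?case using ag unfolding agree_def sat.simps by metis
next
  case (AuxAtom R ts)
  then have "map (eval_trm \<S> as bs) ts = map (eval_trm \<S>' as bs) ts"
    "map (eval_trm \<S> as bs) ts \<in> tuples (X N) (aux_arity \<sigma> R)" "R \<in> aux_rels \<sigma>"
    using agree_eval_trms[OF ag sub, of ts] by auto
  then show ?case using ag unfolding agree_def sat.simps by metis
qed auto

lemma agree_eval_update_term:
  assumes ag: "agree \<sigma> N X \<S> \<S>'"
    and sub: "set as \<subseteq> X i" "set bs \<subseteq> X i"
    and "wf_update_term \<sigma> (length as) (length bs) t" "i + size t \<le> N"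
  shows "eval_update_term \<S> as bs t = eval_update_term \<S>' as bs t \<and>
    eval_update_term \<S> as bs t \<in> X (i + size t)"
  using assms(4,5)
proof (induction t)
  case (UVar v)
  have "X i \<subseteq> X (i + size (UVar v :: ('a, 'b, 'c) update_term))"
    using ag by (simp add: agree_def monoD)
  then show ?case using UVar eval_var_in[OF _ sub] by auto
next
  case (UApp f ts)
  let ?j = "i + size_list size ts"
  have mono: "mono X" using ag by (simp add: agree_def)
  have IH: "eval_update_term \<S> as bs t = eval_update_term \<S>' as bs t \<and>
      eval_update_term \<S> as bs t \<in> X ?j"
    if t: "t \<in> set ts" for t
  proof -
    have le: "size t \<le> size_list size ts" using t by (rule size_list_estimation') simp
    have "eval_update_term \<S> as bs t = eval_update_term \<S>' as bs t \<and>
        eval_update_term \<S> as bs t \<in> X (i + size t)"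
      using UApp.IH[OF t] UApp.prems t le by auto
    moreover have "X (i + size t) \<subseteq> X ?j" using mono le by (simp add: monoD)
    ultimately show ?thesis by blast
  qed
  have eq: "map (eval_update_term \<S> as bs) ts = map (eval_update_term \<S>' as bs) ts"
    using IH by simp
  have "map (eval_update_term \<S> as bs) ts \<in> tuples (X ?j) (fun_arity \<sigma> f)"
    using IH[THEN conjunct2] UApp.prems by (auto simp: tuples_def)
  moreover have "?j < N" "f \<in> aux_funs \<sigma>" using UApp.prems by auto
  ultimately have "fun_of (state_aux \<S>) f (map (eval_update_term \<S> as bs) ts) =
      fun_of (state_aux \<S>') f (map (eval_update_term \<S> as bs) ts)"
      "fun_of (state_aux \<S>) f (map (eval_update_term \<S> as bs) ts) \<in> X (Suc ?j)"
    using ag unfolding agree_def by blast+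
  then show ?case by (simp flip: eq del: map_eq_conv)
next
  case (ITE \<phi> s t)
  have mono: "mono X" using ag by (simp add: agree_def)
  \<comment> \<open>The condition has the same truth value in both states, so both take the same
    branch, and neither branch climbs higher than the size of the whole term allows.\<close>
  have "X (i + size s) \<subseteq> X (i + size (ITE \<phi> s t))" "X (i + size t) \<subseteq> X (i + size (ITE \<phi> s t))"
    using mono by (simp_all add: monoD)
  moreover have "sat \<S> as bs \<phi> \<longleftrightarrow> sat \<S>' as bs \<phi>"
    using agree_sat[OF ag sub] ITE.prems by simp
  ultimately show ?case using ITE by auto
qed

text \<open>One modification costs a factor of \<open>d\<close> in the number of closure levels, since an update of
  size at most \<open>d\<close> moves at most \<open>d\<close> levels up.\<close>

lemma agree_apply_mod:
  assumes P: "DynProp_program P"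
    and ag: "agree P (d * Suc n) X \<S> \<S>'"
    and \<delta>: "mod_rel \<delta> \<in> in_rels P" "as \<in> tuples (X 0) (in_arity P (mod_rel \<delta>))"
    and dR: "\<forall>R\<in>aux_rels P. size (rel_update P R \<delta>) \<le> d"
    and df: "\<forall>f\<in>aux_funs P. size (fun_update P f \<delta>) \<le> d"
  shows "agree P n (\<lambda>i. X (d * i)) (apply_mod P (\<delta>, as) \<S>) (apply_mod P (\<delta>, as) \<S>')"
proof -
  have mono: "mono X" and dom: "state_dom \<S> = state_dom \<S>'" using ag by (simp_all add: agree_def)
  have as: "set as \<subseteq> X i" "length as = in_arity P (mod_rel \<delta>)" for i
    using \<delta>(2) monoD[OF mono, of 0 i] by (auto simp: tuples_def)
  have "eval_update_term \<S>' as bs (fun_update P f \<delta>) = eval_update_term \<S> as bs (fun_update P f \<delta>) \<and>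
      eval_update_term \<S> as bs (fun_update P f \<delta>) \<in> X (d * Suc i)"
    if "i < n" "f \<in> aux_funs P" "bs \<in> tuples (X (d * i)) (fun_arity P f)" for i f bs
  proof -
    let ?t = "fun_update P f \<delta>"
    have wf: "wf_update_term P (length as) (length bs) ?t"
      using P \<delta> that as(2) by (auto simp: DynProp_program_def tuples_def)
    have sub: "set bs \<subseteq> X (d * i)" using that by (simp add: tuples_def)
    have le: "d * i + size ?t \<le> d * Suc i" using df that by simp
    also have "d * Suc i \<le> d * Suc n" using that by (intro mult_le_mono2) simp
    finally have "eval_update_term \<S> as bs ?t = eval_update_term \<S>' as bs ?t \<and>
        eval_update_term \<S> as bs ?t \<in> X (d * i + size ?t)"
      by (rule agree_eval_update_term[OF ag as(1) sub wf])
    moreover have "X (d * i + size ?t) \<subseteq> X (d * Suc i)"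
      using le by (rule monoD[OF mono])
    ultimately show ?thesis by auto
  qed
  \<comment> \<open>The extra block of \<open>d\<close> levels in \<open>d * Suc n\<close> is spent
    here: arguments from the top new level \<open>d * n\<close> may still have up to
    \<open>d\<close> functions applied to them.\<close>
  moreover have "sat \<S> as bs (rel_update P R \<delta>) \<longleftrightarrow> sat \<S>' as bs (rel_update P R \<delta>)"
    if "R \<in> aux_rels P" "bs \<in> tuples (X (d * n)) (aux_arity P R)" for R bs
  proof (rule agree_sat[OF ag as(1)])
    show "set bs \<subseteq> X (d * n)" using that by (simp add: tuples_def)
    show "wf_formula P (length as) (length bs) (rel_update P R \<delta>)"
      using P \<delta> that as(2) by (auto simp: DynProp_program_def tuples_def)
    show "d * n + size (rel_update P R \<delta>) \<le> d * Suc n" using dR that by simp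
  qed
  moreover have "bs \<in> modify (\<delta>, as) (state_in \<S>) S \<longleftrightarrow> bs \<in> modify (\<delta>, as) (state_in \<S>') S"
    if "S \<in> in_rels P" "bs \<in> tuples (X (d * n)) (in_arity P S)" for S bs
  proof -
    have "X (d * n) \<subseteq> X (d * Suc n)" by (rule monoD[OF mono]) simp
    then have "bs \<in> tuples (X (d * Suc n)) (in_arity P S)" using that by (auto simp: tuples_def)
    then have "bs \<in> state_in \<S> S \<longleftrightarrow> bs \<in> state_in \<S>' S"
      using ag that unfolding agree_def by blast
    then show ?thesis by (cases \<delta>) auto
  qed
  moreover have "mono (\<lambda>i. X (d * i))" using mono by (simp add: mono_def)
  ultimately show ?thesis using dom by (simp add: agree_def)
qed

text \<open>To keep \<open>n\<close> levels after a modification, \<open>d * Suc n\<close> are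
  needed before it. After the last modification 0 levels suffice, since the query symbol is
  nullary.\<close>

fun levels :: "nat \<Rightarrow> nat \<Rightarrow> nat" where
  "levels d 0 = 0"
| "levels d (Suc l) = d * Suc (levels d l)"

lemma agree_fold_apply_mod:
  assumes P: "DynProp_program P"
    and "agree P (levels d (length \<alpha>)) X \<S> \<S>'"
    and "\<forall>(\<delta>, as)\<in>set \<alpha>. mod_rel \<delta> \<in> in_rels P \<and> as \<in> tuples (X 0) (in_arity P (mod_rel \<delta>)) \<and>
      (\<forall>R\<in>aux_rels P. size (rel_update P R \<delta>) \<le> d) \<and>
      (\<forall>f\<in>aux_funs P. size (fun_update P f \<delta>) \<le> d)"
  shows "query_value P (fold (apply_mod P) \<alpha> \<S>) \<longleftrightarrow> query_value P (fold (apply_mod P) \<alpha> \<S>')"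
  using assms(2,3)
proof (induction \<alpha> arbitrary: X \<S> \<S>')
  case Nil
  have "[] \<in> tuples (X 0) (aux_arity P (query_sym P))" "query_sym P \<in> aux_rels P"
    using P by (auto simp: DynProp_program_def tuples_def)
  then show ?case using Nil(1) unfolding agree_def query_value_def by simp
next
  case (Cons m \<alpha>)
  obtain \<delta> as where m: "m = (\<delta>, as)" by force
  have "agree P (levels d (length \<alpha>)) (\<lambda>i. X (d * i)) (apply_mod P m \<S>) (apply_mod P m \<S>')"
    unfolding m by (rule agree_apply_mod[OF P]) (use Cons.prems m in auto)
  \<comment> \<open>The tuples still to be inserted or deleted remain in level 0, as
    \<open>d * 0 = 0\<close>.\<close>
  from Cons.IH[OF this] Cons.prems(2) show ?case by simp
qed


section \<open>Closure under bounded iteration of unary functions\<close>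

text \<open>Keeping the previous level makes the chain increasing, as \<open>agree\<close> demands.
  Constants enter through the empty tuple.\<close>

fun fun_closure ::
    "('i, 'r, 'f, 'z) dyn_schema_scheme \<Rightarrow> ('r, 'f, 'd) aux_data \<Rightarrow> 'd set \<Rightarrow> nat \<Rightarrow> 'd set" where
  "fun_closure \<sigma> A Z 0 = Z"
| "fun_closure \<sigma> A Z (Suc n) = fun_closure \<sigma> A Z n \<union>
     (\<Union>f\<in>aux_funs \<sigma>. fun_of A f ` tuples (fun_closure \<sigma> A Z n) (fun_arity \<sigma> f))"

lemma mono_fun_closure: "mono (fun_closure \<sigma> A Z)"
  by (simp add: mono_iff_le_Suc)

lemma fun_closure_subset:
  assumes "auxiliary_data \<sigma> D A" "Z \<subseteq> D"
  shows "fun_closure \<sigma> A Z n \<subseteq> D"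
  using assms by (induction n) (force simp: auxiliary_data_def tuples_def)+

text \<open>This is where the arity bound on functions matters: there are no more arguments than
  elements. Nonemptiness of \<open>Z\<close> covers \<open>m = 0\<close> with its single empty
  tuple.\<close>

lemma card_tuples_le:
  assumes "finite Z" "Z \<noteq> {}" "m \<le> 1"
  shows "finite (tuples Z m)" "card (tuples Z m) \<le> card Z"
proof -
  have "card Z \<ge> 1" using assms by (simp add: Suc_le_eq card_gt_0_iff)
  moreover have "m = 0 \<or> m = 1" using assms by linarith
  ultimately show "finite (tuples Z m)" "card (tuples Z m) \<le> card Z"
    using assms by (auto simp: tuples_def finite_lists_length_eq card_lists_length_eq)
qed

text \<open>Every function adds at most one element per element already present, so for fixed
  \<open>n\<close> the closure is linear in \<open>card Z\<close>.\<close>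

lemma card_fun_closure:
  assumes F: "finite (aux_funs \<sigma>)" "\<forall>f\<in>aux_funs \<sigma>. fun_arity \<sigma> f \<le> 1" and Z: "finite Z" "Z \<noteq> {}"
  shows "finite (fun_closure \<sigma> A Z n) \<and> fun_closure \<sigma> A Z n \<noteq> {} \<and>
    card (fun_closure \<sigma> A Z n) \<le> Suc (card (aux_funs \<sigma>)) ^ n * card Z"
proof (induction n)
  case 0
  then show ?case using Z by simp
next
  case (Suc n)
  let ?Y = "fun_closure \<sigma> A Z n"
  let ?g = "\<lambda>f. fun_of A f ` tuples ?Y (fun_arity \<sigma> f)"
  have fin: "finite (?g f)" "card (?g f) \<le> card ?Y" if "f \<in> aux_funs \<sigma>" for f
    using card_tuples_le[of ?Y "fun_arity \<sigma> f"] Suc F(2) that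
    by (auto intro: order_trans[OF card_image_le])
  have "card (\<Union>f\<in>aux_funs \<sigma>. ?g f) \<le> (\<Sum>f\<in>aux_funs \<sigma>. card (?g f))"
    using F(1) by (rule card_UN_le)
  also have "\<dots> \<le> card (aux_funs \<sigma>) * card ?Y"
    using sum_bounded_above[of "aux_funs \<sigma>" "\<lambda>f. card (?g f)" "card ?Y"] fin(2) by simp
  finally have "card (fun_closure \<sigma> A Z (Suc n)) \<le> Suc (card (aux_funs \<sigma>)) * card ?Y"
    using card_Un_le[of ?Y "\<Union>f\<in>aux_funs \<sigma>. ?g f"] by simp
  also have "\<dots> \<le> Suc (card (aux_funs \<sigma>)) * (Suc (card (aux_funs \<sigma>)) ^ n * card Z)"
    using Suc by (intro mult_le_mono2) simp
  finally show ?case using Suc fin(1) F(1) by (simp add: algebra_simps)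
qed


section \<open>Counting bounded views of auxiliary data\<close>

text \<open>Surplus indices repeat one element, so that sets of different sizes can share an index
  set.\<close>

lemma ex_enumeration:
  assumes "finite Y" "Y \<noteq> {}" "card Y \<le> M"
  shows "\<exists>e\<in>{..<M} \<rightarrow>\<^sub>E Y. e ` {..<M} = Y"
proof -
  obtain g where g: "bij_betw g {0..<card Y} Y" using ex_bij_betw_nat_finite assms(1) by blast
  obtain y where y: "y \<in> Y" using assms(2) by blast
  define e where "e = (\<lambda>i\<in>{..<M}. if i < card Y then g i else y)"
  have "e i \<in> Y" if "i < M" for i
    using g y that by (auto simp: e_def bij_betw_def)
  then have "e \<in> {..<M} \<rightarrow>\<^sub>E Y" by (auto simp: e_def)
  moreover have "Y \<subseteq> e ` {..<M}"
  proof
    fix z assume "z \<in> Y"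
    then obtain i where "i < card Y" "z = g i" using bij_betw_imp_surj_on[OF g] by force
    then have "z = e i" "i < M" using assms(3) by (auto simp: e_def)
    then show "z \<in> e ` {..<M}" by blast
  qed
  ultimately show ?thesis by (intro bexI[of _ e]) auto
qed

lemma card_lists_le:
  assumes "M > 0"
  shows "card {is. set is \<subseteq> {..<M} \<and> length is \<le> k} \<le> Suc k * M ^ k"
proof -
  have "card {is. set is \<subseteq> {..<M} \<and> length is \<le> k} = (\<Sum>i\<le>k. M ^ i)"
    by (subst card_lists_length_le) auto
  also have "\<dots> \<le> (\<Sum>i\<le>k. M ^ k)"
    using assms by (intro sum_mono power_increasing) auto
  finally show ?thesis by simp
qed

text \<open>The set \<open>Y c\<close> is the part of the domain that can be inspected, and \<open>B c\<close> is a set of marked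
  elements. An enumeration of \<open>Y c\<close> by \<open>{..<M}\<close> makes all views elements of one finite set.\<close>

lemma views_pigeonhole:
  fixes A :: "'c \<Rightarrow> ('r, 'f, 'd) aux_data" and \<sigma> :: "('i, 'r, 'f, 'z) dyn_schema_scheme"
  assumes \<sigma>: "finite (aux_funs \<sigma>)" "finite (aux_rels \<sigma>)"
      "\<forall>f\<in>aux_funs \<sigma>. fun_arity \<sigma> f \<le> 1" "\<forall>R\<in>aux_rels \<sigma>. aux_arity \<sigma> R \<le> k"
    and D: "finite D"
    and A: "\<And>c. c \<in> \<C> \<Longrightarrow> auxiliary_data \<sigma> D (A c)"
    and Y: "\<And>c. c \<in> \<C> \<Longrightarrow> Y c \<subseteq> D" "\<And>c. c \<in> \<C> \<Longrightarrow> Y c \<noteq> {}" "\<And>c. c \<in> \<C> \<Longrightarrow> card (Y c) \<le> M"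
    and M: "M > 0"
    and many: "card D ^ (M + card (aux_funs \<sigma>) * M) *
      2 ^ (card (aux_rels \<sigma>) * (Suc k * M ^ k) + M) < card \<C>"
  obtains c c' where "c \<in> \<C>" "c' \<in> \<C>" "c \<noteq> c'" "Y c = Y c'"
    "\<And>f bs. f \<in> aux_funs \<sigma> \<Longrightarrow> bs \<in> tuples (Y c) (fun_arity \<sigma> f) \<Longrightarrow>
       fun_of (A c) f bs = fun_of (A c') f bs"
    "\<And>R bs. R \<in> aux_rels \<sigma> \<Longrightarrow> bs \<in> tuples (Y c) (aux_arity \<sigma> R) \<Longrightarrow>
       bs \<in> rel_of (A c) R \<longleftrightarrow> bs \<in> rel_of (A c') R"
    "B c \<inter> Y c = B c' \<inter> Y c"
proof -
  have "\<exists>e. \<forall>c\<in>\<C>. e c \<in> {..<M} \<rightarrow>\<^sub>E Y c \<and> e c ` {..<M} = Y c"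
  proof (intro bchoice ballI)
    fix c assume c: "c \<in> \<C>"
    show "\<exists>e. e \<in> {..<M} \<rightarrow>\<^sub>E Y c \<and> e ` {..<M} = Y c"
      using ex_enumeration[OF finite_subset[OF Y(1)[OF c] D] Y(2)[OF c] Y(3)[OF c]]
      by (simp only: Bex_def)
  qed
  then obtain e where e: "\<And>c. c \<in> \<C> \<Longrightarrow> e c \<in> {..<M} \<rightarrow>\<^sub>E Y c" "\<And>c. c \<in> \<C> \<Longrightarrow> e c ` {..<M} = Y c"
    by blast
  \<comment> \<open>For a constant the index is ignored, so constants and unary functions fit into
    one table over \<open>aux_funs \<sigma> \<times> {..<M}\<close>.\<close>
  define arg where "arg c f i = (if fun_arity \<sigma> f = 0 then [] else [e c i])" for c f i
  define vfun where "vfun c = (\<lambda>(f, i)\<in>aux_funs \<sigma> \<times> {..<M}. fun_of (A c) f (arg c f i))" for c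
  \<comment> \<open>Relations are pulled back along the enumeration to lists of indices, which makes
    views over different sets \<open>Y c\<close> comparable.\<close>
  define vrel where "vrel c = {(R, is). R \<in> aux_rels \<sigma> \<and> set is \<subseteq> {..<M} \<and>
    length is = aux_arity \<sigma> R \<and> map (e c) is \<in> rel_of (A c) R}" for c
  define vmark where "vmark c = {i\<in>{..<M}. e c i \<in> B c}" for c
  define L where "L = {is::nat list. set is \<subseteq> {..<M} \<and> length is \<le> k}"
  have finL: "finite L" unfolding L_def by (simp add: finite_lists_length_le)
  define view where "view c = (e c, vfun c, vrel c, vmark c)" for c
  define \<V> where "\<V> = ({..<M} \<rightarrow>\<^sub>E D) \<times> (aux_funs \<sigma> \<times> {..<M} \<rightarrow>\<^sub>E D) \<times>
    Pow (aux_rels \<sigma> \<times> L) \<times> Pow {..<M}"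
  have arg: "arg c f i \<in> tuples (Y c) (fun_arity \<sigma> f)" if "c \<in> \<C>" "f \<in> aux_funs \<sigma>" "i < M" for c f i
  proof -
    have "fun_arity \<sigma> f \<le> 1" using \<sigma>(3) that by blast
    then show ?thesis using e(1)[of c] that by (auto simp: arg_def tuples_def)
  qed
  have "view c \<in> \<V>" if c: "c \<in> \<C>" for c
  proof -
    have "e c \<in> {..<M} \<rightarrow>\<^sub>E D" using e(1)[OF c] Y(1)[OF c] by (auto simp: PiE_def Pi_def)
    moreover have "vfun c \<in> aux_funs \<sigma> \<times> {..<M} \<rightarrow>\<^sub>E D"
    proof -
      have "fun_of (A c) f (arg c f i) \<in> D" if "f \<in> aux_funs \<sigma>" "i < M" for f i
        using arg[OF c that] A[OF c] Y(1)[OF c] that by (auto simp: auxiliary_data_def tuples_def)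
      then show ?thesis by (auto simp: vfun_def)
    qed
    moreover have "vrel c \<subseteq> aux_rels \<sigma> \<times> L" using \<sigma>(4) by (auto simp: vrel_def L_def)
    moreover have "vmark c \<subseteq> {..<M}" by (auto simp: vmark_def)
    ultimately show ?thesis by (simp add: view_def \<V>_def)
  qed
  moreover have "finite \<V>"
    unfolding \<V>_def using D \<sigma> finL by (intro finite_cartesian_product finite_PiE) auto
  ultimately have "card (view ` \<C>) \<le> card \<V>" by (intro card_mono) auto
  \<comment> \<open>The power of \<open>card D\<close> counts enumerations and function tables, the
    power of 2 counts relations and marks.\<close>
  also have "card \<V> = card D ^ (M + card (aux_funs \<sigma>) * M) * 2 ^ (card (aux_rels \<sigma>) * card L + M)"
    using \<sigma> finL by (simp add: \<V>_def card_cartesian_product card_PiE card_Pow power_add)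
  also have "\<dots> \<le> card D ^ (M + card (aux_funs \<sigma>) * M) *
      2 ^ (card (aux_rels \<sigma>) * (Suc k * M ^ k) + M)"
    using card_lists_le[OF M, of k] unfolding L_def
    by (intro mult_le_mono2 power_increasing add_mono order_refl) auto
  finally have "\<not> inj_on view \<C>" using many by (intro pigeonhole) linarith
  then obtain c c' where cc: "c \<in> \<C>" "c' \<in> \<C>" "c \<noteq> c'" and "view c = view c'"
    by (auto simp: inj_on_def)
  then have eqs: "e c' = e c" "vfun c = vfun c'" "vrel c = vrel c'" "vmark c = vmark c'"
    by (auto simp: view_def)
  show thesis
  proof (rule that[OF cc])
    \<comment> \<open>The enumeration is itself a component of the view, and its image is the
      inspected set.\<close>
    show YY: "Y c = Y c'" using e(2) eqs(1) cc by metis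
    have elem: "\<exists>i<M. y = e c i" if "y \<in> Y c" for y using e(2)[OF cc(1)] that by auto
    show "fun_of (A c) f bs = fun_of (A c') f bs"
      if f: "f \<in> aux_funs \<sigma>" and bs: "bs \<in> tuples (Y c) (fun_arity \<sigma> f)" for f bs
    proof -
      have "\<exists>i<M. bs = arg c f i"
      proof (cases "fun_arity \<sigma> f = 0")
        case True
        then show ?thesis using bs M by (auto simp: arg_def tuples_def)
      next
        case False
        then have "fun_arity \<sigma> f = 1" using \<sigma>(3) f by (metis le_neq_implies_less less_one)
        then obtain y where "bs = [y]" "y \<in> Y c"
          using bs by (auto simp: tuples_def length_Suc_conv)
        then show ?thesis using elem False by (auto simp: arg_def)
      qed
      then obtain i where i: "i < M" "bs = arg c f i" by blast
      moreover have "arg c' f i = arg c f i" by (simp add: arg_def eqs(1))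
      ultimately show ?thesis using fun_cong[OF eqs(2), of "(f, i)"] f by (simp add: vfun_def)
    qed
    show "bs \<in> rel_of (A c) R \<longleftrightarrow> bs \<in> rel_of (A c') R"
      if R: "R \<in> aux_rels \<sigma>" and bs: "bs \<in> tuples (Y c) (aux_arity \<sigma> R)" for R bs
    proof -
      have "bs \<in> lists (e c ` {..<M})" using bs e(2)[OF cc(1)] by (auto simp: tuples_def)
      then have "bs \<in> map (e c) ` lists {..<M}" by (simp only: lists_image)
      then obtain "is" where "is": "set is \<subseteq> {..<M}" "bs = map (e c) is" by auto
      then have "length is = aux_arity \<sigma> R" using bs by (simp add: tuples_def)
      then have "bs \<in> rel_of (A x) R \<longleftrightarrow> (R, is) \<in> vrel x" if "x = c \<or> x = c'" for x
        using "is" R that eqs(1) by (auto simp: vrel_def)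
      then show ?thesis using eqs(3) by metis
    qed
    have "y \<in> B c \<longleftrightarrow> y \<in> B c'" if "y \<in> Y c" for y
    proof -
      from elem[OF that] obtain i where "i < M" "y = e c i" by blast
      then have "y \<in> B x \<longleftrightarrow> i \<in> vmark x" if "x = c \<or> x = c'" for x
        using that eqs(1) by (auto simp: vmark_def)
      then show ?thesis using eqs(4) by metis
    qed
    then show "B c \<inter> Y c = B c' \<inter> Y c" by blast
  qed
qed

section \<open>Asymptotics: fewer views than graphs\<close>

lemma linear_less_power2: "\<exists>s. K * Suc s < 2 ^ s" for K :: nat
proof (intro exI)
  \<comment> \<open>The witness is \<open>2 * K + 2\<close>, whose power of two splits into
    \<open>2 ^ K\<close>, exceeding \<open>K\<close>, and \<open>2 ^ (K + 2)\<close>, which is at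
    least \<open>2 * K + 3\<close>.\<close>
  have "Suc (2 * K + 2) \<le> 2 ^ Suc (Suc K)" by (induction K) auto
  with less_exp[of K] have "K * Suc (2 * K + 2) < 2 ^ K * 2 ^ Suc (Suc K)"
    by (rule mult_less_le_imp_less) simp_all
  also have "\<dots> = 2 ^ (2 * K + 2)" 
    by (subst power_add[symmetric], rule arg_cong[of _ _ "(^) 2"]) simp
  finally show "K * Suc (2 * K + 2) < 2 ^ (2 * K + 2)" .
qed

text \<open>Here \<open>n = 2 ^ s\<close> is the size of a part, \<open>N\<close> stands for the
  domain size, \<open>M\<close> for the bound on the inspected part, and \<open>F\<close> and
  \<open>r\<close> for the numbers of functions and relations. As \<open>n\<close> is a power of
  two, \<open>N\<close> has binary logarithm at most \<open>(k + 2) * Suc s\<close>. The total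
  exponent is then at most a constant times \<open>n ^ k * Suc s\<close>, and
  \<open>n ^ k * n\<close> exceeds this for suitable \<open>s\<close>.\<close>

lemma few_views:
  fixes k F r b :: nat
  assumes "k \<ge> 1"
  obtains s :: nat where "\<And>N M. N \<le> Suc k * 2 ^ s + (2 ^ s) ^ Suc k \<Longrightarrow> M = b * 2 ^ s \<Longrightarrow>
    N ^ (M + F * M) * 2 ^ (r * (Suc k * M ^ k) + M) < 2 ^ ((2 ^ s) ^ Suc k)"
proof -
  \<comment> \<open>The summands collect the constants for elements and function values, for
    relations, and for marks.\<close>
  define K where "K = (k + 2) * (b + F * b) + r * (Suc k * b ^ k) + b"
  obtain s where s: "K * Suc s < 2 ^ s" using linear_less_power2 by blast
  define n :: nat where "n = 2 ^ s"
  have n: "n \<ge> 1" "n \<le> n ^ k" using assms by (auto simp: n_def self_le_power)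
  show thesis
  proof (rule that[of s])
    fix N M :: nat
    assume N: "N \<le> Suc k * 2 ^ s + (2 ^ s) ^ Suc k" and M: "M = b * 2 ^ s"
    have "N \<le> Suc k * n ^ Suc k + n ^ Suc k"
      using N n self_le_power[of n "Suc k"] by (fold n_def) (meson add_le_mono1 le_trans mult_le_mono2 zero_less_Suc)
    also have "\<dots> = (k + 2) * n ^ Suc k" by simp
    also have "\<dots> \<le> 2 ^ (k + 2) * n ^ Suc k" by (intro mult_le_mono1 less_imp_le less_exp)
    also have "\<dots> = 2 ^ (k + 2 + s * Suc k)" by (simp add: n_def power_add power_mult)
    also have "\<dots> \<le> 2 ^ ((k + 2) * Suc s)" by (intro power_increasing) auto
    finally have "N ^ (M + F * M) \<le> (2 ^ ((k + 2) * Suc s)) ^ (M + F * M)" by (rule power_mono) simp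
    then have "N ^ (M + F * M) * 2 ^ (r * (Suc k * M ^ k) + M) \<le>
        2 ^ ((k + 2) * Suc s * (M + F * M) + (r * (Suc k * M ^ k) + M))"
      unfolding power_add[of 2 "(k + 2) * Suc s * (M + F * M)"] power_mult[of 2 "(k + 2) * Suc s"]
      by (rule mult_le_mono1)
    also have "\<dots> < 2 ^ ((2 ^ s) ^ Suc k)"
    proof (rule power_strict_increasing)
      have M': "M = b * n" by (simp add: M n_def)
      have "(k + 2) * Suc s * (M + F * M) = (k + 2) * (b + F * b) * (n * Suc s)"
        by (simp add: M' algebra_simps)
      \<comment> \<open>The assumption \<open>k \<ge> 1\<close> enters as
        \<open>n \<le> n ^ k\<close>, which absorbs the linear terms.\<close>
      also have "\<dots> \<le> (k + 2) * (b + F * b) * (n ^ k * Suc s)"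
        using n by (intro mult_le_mono2 mult_le_mono1)
      finally have 1: "(k + 2) * Suc s * (M + F * M) \<le> (k + 2) * (b + F * b) * (n ^ k * Suc s)" .
      have "r * (Suc k * M ^ k) = r * (Suc k * b ^ k) * n ^ k"
        by (simp add: M' power_mult_distrib algebra_simps)
      also have "\<dots> \<le> r * (Suc k * b ^ k) * (n ^ k * Suc s)" by (intro mult_le_mono2) simp
      finally have 2: "r * (Suc k * M ^ k) \<le> r * (Suc k * b ^ k) * (n ^ k * Suc s)" .
      have "n * 1 \<le> n ^ k * Suc s" using n by (intro mult_le_mono) auto
      then have 3: "M \<le> b * (n ^ k * Suc s)" unfolding M' by (intro mult_le_mono2) simp
      have "(k + 2) * Suc s * (M + F * M) + (r * (Suc k * M ^ k) + M) \<le> K * (n ^ k * Suc s)"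
        using 1 2 3 unfolding K_def distrib_right by linarith
      also have "\<dots> = n ^ k * (K * Suc s)" by (simp only: mult_ac)
      also have "\<dots> < n ^ k * n" using s n by (simp add: n_def)
      finally show "(k + 2) * Suc s * (M + F * M) + (r * (Suc k * M ^ k) + M) < (2 ^ s) ^ Suc k"
        by (simp add: n_def mult.commute)
    qed simp
    finally show "N ^ (M + F * M) * 2 ^ (r * (Suc k * M ^ k) + M) < 2 ^ ((2 ^ s) ^ Suc k)" .
  qed
qed


section \<open>Cones over faces of a complete multipartite hypergraph\<close>

text \<open>The base vertices \<open>h (Inl (i, x))\<close> form parts indexed by \<open>i\<close>. A list \<open>c\<close> is the transversal
  picking \<open>c ! i\<close> from part \<open>i\<close>, and \<open>h (Inr c)\<close> is its apex.\<close>

definition face :: "((nat \<times> nat) + nat list \<Rightarrow> 'd) \<Rightarrow> nat list \<Rightarrow> 'd list" where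
  "face h c = map (\<lambda>i. h (Inl (i, c ! i))) [0..<length c]"

definition cones :: "((nat \<times> nat) + nat list \<Rightarrow> 'd) \<Rightarrow> nat list set \<Rightarrow> (graph_sym, 'd) database" where
  "cones h C = (\<lambda>_. {[h (Inr c), y] |c y. c \<in> C \<and> y \<in> set (face h c)})"

text \<open>Taking all ordered pairs, loops included, makes the number of insertions depend only on
  \<open>length c\<close>. Loops do not affect cliques, whose vertices are distinct.\<close>

definition fill_face :: "((nat \<times> nat) + nat list \<Rightarrow> 'd) \<Rightarrow> nat list \<Rightarrow>
    (graph_sym modification \<times> 'd list) list" where
  "fill_face h c = map (Pair (Ins E)) (List.n_lists 2 (face h c))"

lemma fold_modify_Ins: "fold modify (map (Pair (Ins E)) ts) I E = I E \<union> set ts"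
  by (induction ts arbitrary: I) auto

lemma fill_face_edges:
  "fold modify (fill_face h c) I E = I E \<union> tuples (set (face h c)) 2"
  unfolding fill_face_def fold_modify_Ins set_n_lists tuples_def by auto

lemma length_face [simp]: "length (face h c) = length c"
  by (simp add: face_def)

lemma Clique_alt:
  "Clique m D I \<longleftrightarrow> (\<exists>W. W \<subseteq> D \<and> finite W \<and> card W = m \<and>
     (\<forall>x\<in>W. \<forall>y\<in>W. x \<noteq> y \<longrightarrow> [x, y] \<in> I E \<or> [y, x] \<in> I E))"
proof
  assume "Clique m D I"
  then obtain vs where vs: "length vs = m" "distinct vs" "set vs \<subseteq> D"
    and adj: "\<forall>i<m. \<forall>j<m. i \<noteq> j \<longrightarrow> [vs ! i, vs ! j] \<in> I E \<or> [vs ! j, vs ! i] \<in> I E"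
    unfolding Clique_def by blast
  have "[x, y] \<in> I E \<or> [y, x] \<in> I E" if "x \<in> set vs" "y \<in> set vs" "x \<noteq> y" for x y
    using that adj vs(1) by (metis in_set_conv_nth)
  then show "\<exists>W. W \<subseteq> D \<and> finite W \<and> card W = m \<and>
     (\<forall>x\<in>W. \<forall>y\<in>W. x \<noteq> y \<longrightarrow> [x, y] \<in> I E \<or> [y, x] \<in> I E)"
    using vs by (intro exI[of _ "set vs"]) (auto simp: distinct_card)
next
  assume "\<exists>W. W \<subseteq> D \<and> finite W \<and> card W = m \<and>
     (\<forall>x\<in>W. \<forall>y\<in>W. x \<noteq> y \<longrightarrow> [x, y] \<in> I E \<or> [y, x] \<in> I E)"
  then obtain W where W: "W \<subseteq> D" "finite W" "card W = m"
    and adj: "\<And>x y. x \<in> W \<Longrightarrow> y \<in> W \<Longrightarrow> x \<noteq> y \<Longrightarrow> [x, y] \<in> I E \<or> [y, x] \<in> I E" by blast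
  obtain vs where vs: "set vs = W" "distinct vs" using finite_distinct_list[OF W(2)] by blast
  have "length vs = m" using vs W(3) distinct_card by metis
  then show "Clique m D I" unfolding Clique_def
    using vs W(1) by (intro exI[of _ vs] conjI allI impI adj) (auto simp: nth_eq_iff_index_eq)
qed

text \<open>Apices are pairwise nonadjacent, so the clique has at most one and contains at least
  \<open>k + 1\<close> other vertices. These must form the filled face, and an apex adjacent to the
  whole face of \<open>c\<close> can only be that of \<open>c\<close> itself.\<close>

lemma Clique_fill_face:
  assumes h: "inj h" and k: "k \<ge> 1"
    and C: "\<forall>c'\<in>C. length c' = Suc k" and c: "length c = Suc k"
    and D: "set (face h c) \<subseteq> D" "h (Inr c) \<in> D"
  shows "Clique (k + 2) D (fold modify (fill_face h c) (cones h C)) \<longleftrightarrow> c \<in> C"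
proof -
  define G where "G = fold modify (fill_face h c) (cones h C) E"
  have G: "[x, y] \<in> G \<longleftrightarrow> x \<in> set (face h c) \<and> y \<in> set (face h c) \<or>
      (\<exists>c'\<in>C. x = h (Inr c') \<and> y \<in> set (face h c'))" for x y
    unfolding G_def fill_face_edges by (auto simp: tuples_def cones_def)
  have apex: "h (Inr c') \<notin> set (face h c'')" for c' c''
    using injD[OF h] by (fastforce simp: face_def)
  have dist: "distinct (face h c)"
    using injD[OF h] by (fastforce simp: face_def distinct_map inj_on_def)
  show ?thesis
  proof
    assume "c \<in> C"
    then show "Clique (k + 2) D (fold modify (fill_face h c) (cones h C))"
      unfolding Clique_alt using D c dist apex G[unfolded G_def]
      by (intro exI[of _ "insert (h (Inr c)) (set (face h c))"]) (auto simp: distinct_card)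
  next
    assume "Clique (k + 2) D (fold modify (fill_face h c) (cones h C))"
    then obtain W where W: "finite W" "card W = k + 2"
      and adj: "\<And>x y. x \<in> W \<Longrightarrow> y \<in> W \<Longrightarrow> x \<noteq> y \<Longrightarrow> [x, y] \<in> G \<or> [y, x] \<in> G"
      unfolding Clique_alt G_def by blast
    \<comment> \<open>All potential apices, whether or not their transversal lies in
      \<open>C\<close>.\<close>
    define V where "V = range (\<lambda>c. h (Inr c))"
    have V: "v \<notin> set (face h c')" if "v \<in> V" for v c' using that apex by (auto simp: V_def)
    have "x = y" if "x \<in> W \<inter> V" "y \<in> W \<inter> V" for x y
      using adj[of x y] that V G by blast
    then have "card (W \<inter> V) \<le> 1" using W(1) by (auto simp: card_le_Suc0_iff_eq)
    then have cW: "card (W - V) \<ge> Suc k"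
      using card_Int_Diff[OF W(1), of V] W(2) by linarith
    have "x \<in> set (face h c)" if x: "x \<in> W - V" for x
    proof -
      \<comment> \<open>As \<open>k \<ge> 1\<close>, there are at least two non-apices, and an edge
        between non-apices can only come from filling the face.\<close>
      have "W - V \<noteq> {x}" using cW k by auto
      then obtain y where y: "y \<in> W - V" "y \<noteq> x" using x by blast
      then show ?thesis using adj[of x y] x G by (auto simp: V_def)
    qed
    then have sub: "W - V \<subseteq> set (face h c)" by blast
    have cf: "card (set (face h c)) = Suc k" using dist c by (simp add: distinct_card)
    then have WV: "W - V = set (face h c)"
      using sub cW by (intro card_seteq) auto
    then have "card (W \<inter> V) = 1" using cf card_Int_Diff[OF W(1), of V] W(2) by simp
    then obtain v where v: "v \<in> W" "v \<in> V" by (metis IntE card_1_singletonE singletonI)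
    have "\<exists>c'\<in>C. v = h (Inr c') \<and> x \<in> set (face h c')" if x: "x \<in> set (face h c)" for x
    proof -
      have "x \<in> W" "x \<notin> V" using x WV by auto
      then show ?thesis using adj[of v x] v V G by (auto simp: V_def)
    qed
    \<comment> \<open>One vertex of the face yields \<open>c'\<close>; by injectivity the same
      \<open>c'\<close> serves for all the others.\<close>
    moreover have "face h c ! 0 \<in> set (face h c)" using c by (intro nth_mem) simp
    ultimately obtain c' where c': "c' \<in> C" "set (face h c) \<subseteq> set (face h c')"
      using injD[OF h] by blast
    \<comment> \<open>A base vertex carries the index of its part, so inclusion of faces fixes
      \<open>c'\<close> coordinate by coordinate.\<close>
    have "c' = c"
    proof (rule nth_equalityI)
      show "length c' = length c" using C c c' by simp
      fix i assume "i < length c'"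
      then have "face h c ! i \<in> set (face h c')" "i < length c"
        using c' C c by (auto intro!: subsetD[OF c'(2)] nth_mem)
      then show "c' ! i = c ! i" by (auto simp: face_def dest!: injD[OF h])
    qed
    then show "c \<in> C" using c' by simp
  qed
qed

text \<open>Every cone edge starts at its apex, and the face below an apex does not depend on
  \<open>C\<close>. So knowing whether \<open>x\<close> is an apex over \<open>C\<close> decides all
  pairs \<open>[x, y]\<close>, even for \<open>y\<close> outside \<open>Y\<close>.\<close>

lemma cones_agree:
  assumes h: "inj h" and x: "x \<in> Y" and eq: "(h \<circ> Inr) ` C \<inter> Y = (h \<circ> Inr) ` C' \<inter> Y"
  shows "[x, y] \<in> cones h C S \<longleftrightarrow> [x, y] \<in> cones h C' S"
proof -
  have "[x, y] \<in> cones h C S \<longleftrightarrow> x \<in> (h \<circ> Inr) ` C \<and> (\<exists>c. x = h (Inr c) \<and> y \<in> set (face h c))" for C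
    using injD[OF h] by (fastforce simp: cones_def)
  then show ?thesis using eq x by blast
qed


section \<open>The lower bound\<close>

theorem theorem6p1:
  fixes k :: nat
  assumes "k \<ge> 1"
    and "infinite (UNIV :: 'd set)"
  shows "\<not> (\<exists>P :: (graph_sym, 'r, 'f, 'd) dyn_program.
            DynProp_program P \<and> graph_program P \<and> unary_functions P \<and> program_arity_le k P \<and>
            maintains_under_insertions P (Clique (k + 2)))"
proof
  assume "\<exists>P :: (graph_sym, 'r, 'f, 'd) dyn_program.
            DynProp_program P \<and> graph_program P \<and> unary_functions P \<and> program_arity_le k P \<and>
            maintains_under_insertions P (Clique (k + 2))"
  then obtain P :: "(graph_sym, 'r, 'f, 'd) dyn_program" where P: "DynProp_program P"
    and gr: "in_rels P = {E}" "in_arity P E = 2"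
    and un: "\<forall>f\<in>aux_funs P. fun_arity P f \<le> 1" and ar: "\<forall>R\<in>aux_rels P. aux_arity P R \<le> k"
    and maint: "maintains_under_insertions P (Clique (k + 2))"
    unfolding graph_program_def unary_functions_def program_arity_le_def by blast
  have fin: "finite (aux_funs P)" "finite (aux_rels P)"
    using P by (auto simp: DynProp_program_def finite_schema_def)
  obtain g :: "nat \<Rightarrow> 'd" where g: "inj g"
    using infinite_countable_subset[OF assms(2)] by blast
  define h :: "(nat \<times> nat) + nat list \<Rightarrow> 'd" where "h = g \<circ> to_nat"
  have h: "inj h" unfolding h_def using g by (intro inj_compose) auto
  \<comment> \<open>A sum bounds all update sizes at once; only \<open>Ins E\<close> is ever
    performed.\<close>
  define d where "d = (\<Sum>R\<in>aux_rels P. size (rel_update P R (Ins E))) +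
    (\<Sum>f\<in>aux_funs P. size (fun_update P f (Ins E)))"
  have dR: "\<forall>R\<in>aux_rels P. size (rel_update P R (Ins E)) \<le> d"
    using member_le_sum[of _ "aux_rels P" "\<lambda>R. size (rel_update P R (Ins E))"] fin
    by (auto simp: d_def intro: trans_le_add1)
  have df: "\<forall>f\<in>aux_funs P. size (fun_update P f (Ins E)) \<le> d"
    using member_le_sum[of _ "aux_funs P" "\<lambda>f. size (fun_update P f (Ins E))"] fin
    by (auto simp: d_def intro: trans_le_add2)
  \<comment> \<open>Filling a face takes \<open>Suc k ^ 2\<close> insertions whatever the part size.
    Hence \<open>T\<close> and \<open>b\<close> are fixed before \<open>s\<close> is chosen, and the
    closure of at most \<open>Suc k * n\<close> base vertices has at most \<open>b * n\<close>
    elements.\<close>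
  define T where "T = levels d (Suc k ^ 2)"
  define b where "b = Suc (card (aux_funs P)) ^ T * Suc k"
  obtain s where few: "\<And>N M. N \<le> Suc k * 2 ^ s + (2 ^ s) ^ Suc k \<Longrightarrow> M = b * 2 ^ s \<Longrightarrow>
      N ^ (M + card (aux_funs P) * M) * 2 ^ (card (aux_rels P) * (Suc k * M ^ k) + M)
        < 2 ^ ((2 ^ s) ^ Suc k)"
    using few_views[OF assms(1)] by blast
  define n :: nat where "n = 2 ^ s"
  define M where "M = b * n"
  define L where "L = {c::nat list. set c \<subseteq> {..<n} \<and> length c = Suc k}"
  define Z where "Z = (h \<circ> Inl) ` ({..<Suc k} \<times> {..<n})"
  \<comment> \<open>The domain contains the apices of all transversals, so it is the same for every
    \<open>C\<close>.\<close>
  define D where "D = Z \<union> (h \<circ> Inr) ` L"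
  have n: "n > 0" by (simp add: n_def)
  have finL: "finite L" and cardL: "card L = n ^ Suc k"
    by (simp_all add: L_def finite_lists_length_eq card_lists_length_eq del: power_Suc)
  have finZ: "finite Z" and cardZ: "card Z \<le> Suc k * n"
    using card_image_le[of "{..<Suc k} \<times> {..<n}" "h \<circ> Inl"] by (simp_all add: Z_def)
  have Z: "Z \<noteq> {}" "Z \<subseteq> D" using n by (auto simp: Z_def D_def)
  have finD: "finite D" using finL finZ by (simp add: D_def)
  have cardD: "card D \<le> Suc k * n + n ^ Suc k"
    using card_Un_le[of Z "(h \<circ> Inr) ` L"] cardZ card_image_le[OF finL, of "h \<circ> Inr"] cardL
    unfolding D_def by linarith
  have faceZ: "set (face h c) \<subseteq> Z" if "c \<in> L" for c
  proof -
    have "c ! i < n" if "i < Suc k" for i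
      using \<open>c \<in> L\<close> that nth_mem[of i c] unfolding L_def by fastforce
    then show ?thesis using that by (auto simp: face_def L_def Z_def)
  qed
  have inp: "input_database P D (cones h C)" if "C \<subseteq> L" for C
    using that faceZ gr Z(2) unfolding input_database_def cones_def tuples_def D_def
    by fastforce
  define A where "A C = Init P D (cones h C)" for C
  define X where "X C = fun_closure P (A C) Z" for C
  have A: "auxiliary_data P D (A C)" if "C \<in> Pow L" for C
    using P inp[of C] that finD Z unfolding DynProp_program_def A_def by blast
  have cardX: "X C i \<noteq> {}" "card (X C i) \<le> Suc (card (aux_funs P)) ^ i * (Suc k * n)" for C i
    using card_fun_closure[OF fin(1) un finZ Z(1), of "A C" i] cardZ
    unfolding X_def by (auto intro: order_trans[OF _ mult_le_mono2])
  have "card D ^ (M + card (aux_funs P) * M) * 2 ^ (card (aux_rels P) * (Suc k * M ^ k) + M)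
      < 2 ^ (n ^ Suc k)"
    using few[of "card D" M] cardD by (simp only: n_def M_def)
  then have many: "card D ^ (M + card (aux_funs P) * M) *
      2 ^ (card (aux_rels P) * (Suc k * M ^ k) + M) < card (Pow L)"
    by (simp only: card_Pow[OF finL] cardL)
  \<comment> \<open>The inspected part is the \<open>T\<close>-level closure of the base vertices;
    the marks are the apices over \<open>C\<close>.\<close>
  obtain C\<^sub>1 C\<^sub>2 where C: "C\<^sub>1 \<in> Pow L" "C\<^sub>2 \<in> Pow L" "C\<^sub>1 \<noteq> C\<^sub>2"
    and funs: "\<And>f bs. f \<in> aux_funs P \<Longrightarrow> bs \<in> tuples (X C\<^sub>1 T) (fun_arity P f) \<Longrightarrow>
       fun_of (A C\<^sub>1) f bs = fun_of (A C\<^sub>2) f bs"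
    and rels: "\<And>R bs. R \<in> aux_rels P \<Longrightarrow> bs \<in> tuples (X C\<^sub>1 T) (aux_arity P R) \<Longrightarrow>
       bs \<in> rel_of (A C\<^sub>1) R \<longleftrightarrow> bs \<in> rel_of (A C\<^sub>2) R"
    and marks: "(h \<circ> Inr) ` C\<^sub>1 \<inter> X C\<^sub>1 T = (h \<circ> Inr) ` C\<^sub>2 \<inter> X C\<^sub>1 T"
  proof (rule views_pigeonhole[where \<sigma> = P and k = k and D = D and \<C> = "Pow L" and A = A
        and Y = "\<lambda>C. X C T" and M = M and B = "\<lambda>C. (h \<circ> Inr) ` C", OF fin un ar finD A])
    show "X C T \<subseteq> D" if "C \<in> Pow L" for C
      unfolding X_def using fun_closure_subset[OF A[OF that] Z(2)] .
    show "card (X C T) \<le> M" for C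
      using cardX(2)[of C T] by (simp only: M_def b_def mult.assoc)
    show "M > 0" using n by (simp add: M_def b_def)
  qed (use many cardX in auto)
  \<comment> \<open>Filling the face of a transversal on which the two sets differ must give
    opposite answers.\<close>
  obtain c where c: "c \<in> L" "c \<in> C\<^sub>1 \<longleftrightarrow> c \<notin> C\<^sub>2" using C by blast
  let ?\<alpha> = "fill_face h c"
  have clen: "length c = Suc k" using c by (simp add: L_def)
  have mods: "m \<in> Pair (Ins E) ` tuples Z 2" if "m \<in> set ?\<alpha>" for m
    using that faceZ[OF c(1)] by (auto simp: fill_face_def set_n_lists tuples_def)
  then have ins: "set ?\<alpha> \<subseteq> insertions P D"
    using gr Z(2) by (fastforce simp: insertions_def tuples_def)
  have correct: "query_value P (fold (apply_mod P) ?\<alpha> (initial_state P D (cones h C))) \<longleftrightarrow> c \<in> C"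
    if "C \<in> Pow L" for C
  proof -
    have "query_value P (fold (apply_mod P) ?\<alpha> (initial_state P D (cones h C))) \<longleftrightarrow>
        Clique (k + 2) D (fold modify ?\<alpha> (cones h C))"
      using maint inp[of C] that ins finD Z unfolding maintains_under_insertions_def by blast
    also have "\<dots> \<longleftrightarrow> c \<in> C"
    proof (rule Clique_fill_face[OF h assms(1)])
      show "\<forall>c'\<in>C. length c' = Suc k" using that by (auto simp: L_def)
      show "set (face h c) \<subseteq> D" using faceZ[OF c(1)] Z(2) by blast
      show "h (Inr c) \<in> D" using c(1) by (simp add: D_def)
    qed (rule clen)
    finally show ?thesis .
  qed
  \<comment> \<open>The closure computed for \<open>C\<^sub>1\<close> serves as the chain for both
    states, since the functions of both agree on its top level.\<close>
  have "agree P T (X C\<^sub>1) (initial_state P D (cones h C\<^sub>1)) (initial_state P D (cones h C\<^sub>2))"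
  proof -
    have mono: "mono (X C\<^sub>1)" unfolding X_def by (rule mono_fun_closure)
    have "fun_of (A C\<^sub>2) f bs = fun_of (A C\<^sub>1) f bs \<and> fun_of (A C\<^sub>1) f bs \<in> X C\<^sub>1 (Suc i)"
      if "i < T" "f \<in> aux_funs P" "bs \<in> tuples (X C\<^sub>1 i) (fun_arity P f)" for i f bs
    proof -
      have "X C\<^sub>1 i \<subseteq> X C\<^sub>1 T" using that by (intro monoD[OF mono]) simp
      then have "bs \<in> tuples (X C\<^sub>1 T) (fun_arity P f)" using that by (auto simp: tuples_def)
      then have "fun_of (A C\<^sub>2) f bs = fun_of (A C\<^sub>1) f bs" using funs that(2) by metis
      moreover have "fun_of (A C\<^sub>1) f bs \<in> X C\<^sub>1 (Suc i)" using that by (auto simp: X_def)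
      ultimately show ?thesis ..
    qed
    moreover have "bs \<in> cones h C\<^sub>1 E \<longleftrightarrow> bs \<in> cones h C\<^sub>2 E" if bs: "bs \<in> tuples (X C\<^sub>1 T) 2" for bs
    proof -
      obtain x y where "bs = [x, y]" "x \<in> X C\<^sub>1 T"
        using bs by (auto simp: tuples_def numeral_2_eq_2 length_Suc_conv)
      then show ?thesis using cones_agree[OF h _ marks] by simp
    qed
    ultimately show ?thesis
      using mono rels gr by (simp add: agree_def initial_state_def A_def)
  qed
  moreover have "length ?\<alpha> = Suc k ^ 2"
    by (simp add: fill_face_def length_n_lists clen)
  moreover have "X C\<^sub>1 0 = Z" by (simp add: X_def)
  ultimately have "query_value P (fold (apply_mod P) ?\<alpha> (initial_state P D (cones h C\<^sub>1))) \<longleftrightarrow>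
      query_value P (fold (apply_mod P) ?\<alpha> (initial_state P D (cones h C\<^sub>2)))"
    using mods gr dR df
    by (intro agree_fold_apply_mod[OF P, where d = d and X = "X C\<^sub>1"]) (fastforce simp: T_def)+
  then show False using correct C c(2) by blast
qed

end
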